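(* Let $T>0$, let $N\ge1$ be an integer, $\Delta t=T/N$, and let $X^f,X^a,X^c$ be the fine, antithetic and coarse approximations of the Clark–Cameron SDE defined in the context. Then $$X^f_{1,n}=X^a_{1,n}=X^c_{1,n},\qquad \tfrac12\big(X^f_{2,n}+X^a_{2,n}\big)=X^c_{2,n}\qquad\text{for all integers } 0\le n\le N,$$ and $$\mathbb{E}\Big[\big(X^f_{2,N}-X^a_{2,N}\big)^4\Big]=\tfrac34\,T\,(T+\Delta t)\,\Delta t^2 .$$
   Context: The Clark–Cameron SDE is $\mathrm{d}x_1=\mathrm{d}w_1$, $\mathrm{d}x_2=x_1\,\mathrm{d}w_2$, $x_1(0)=x_2(0)=0$, with $w_1,w_2$ independent standard Brownian motions. Let $t_n=n\Delta t$, $t_{n+1/2}=(n+\frac12)\Delta t$, $\Delta w_{i,n}=w_i(t_{n+1})-w_i(t_n)$, $\delta w_{i,n}=w_i(t_{n+1/2})-w_i(t_n)$, $\delta w_{i,n+1/2}=w_i(t_{n+1})-w_i(t_{n+1/2})$. For $X=(X_1,X_2)\in\mathbb{R}^2$ and $v\in\mathbb{R}^2$ put $$\Psi(X,v)=\big(X_1+v_1,\ X_2+X_1v_2+\tfrac12v_1v_2\big).$$ All three approximations start at $(0,0)$ at $n=0$, and for $0\le n\le N-1$: coarse path $X^c_{n+1}=\Psi(X^c_n,\Delta w_n)$; fine path $X^f_{n+1/2}=\Psi(X^f_n,\delta w_n)$, $X^f_{n+1}=\Psi(X^f_{n+1/2},\delta w_{n+1/2})$; antithetic path $X^a_{n+1/2}=\Psi(X^a_n,\delta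 w_{n+1/2})$, $X^a_{n+1}=\Psi(X^a_{n+1/2},\delta w_n)$. $X_{i,n}$ denotes the $i$th component of $X_n$. *)

theory Defs
  imports "HOL-Probability.Probability"
begin

text \<open>Only the values at times \<open>t \<ge> 0\<close> matter. The initial value and the continuity of the paths are
  required almost surely.\<close>

definition std_brownian_motion :: "'a measure \<Rightarrow> (real \<Rightarrow> 'a \<Rightarrow> real) \<Rightarrow> bool" where
  "std_brownian_motion M w \<longleftrightarrow>
     prob_space M \<and>
     (\<forall>t\<ge>0. w t \<in> borel_measurable M) \<and>
     (AE \<omega> in M. w 0 \<omega> = 0) \<and>
     (\<forall>(n::nat) t. 0 \<le> t 0 \<and> (\<forall>i<n. t i < t (Suc i)) \<longrightarrow>
        prob_space.indep_vars M (\<lambda>_. borel) (\<lambda>i \<omega>. w (t (Suc i)) \<omega> - w (t i) \<omega>) {..<n}) \<and>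
     (\<forall>s t. 0 \<le> s \<and> s < t \<longrightarrow>
        distributed M lborel (\<lambda>\<omega>. w t \<omega> - w s \<omega>) (normal_density 0 (sqrt (t - s)))) \<and>
     (AE \<omega> in M. continuous_on {0..} (\<lambda>t. w t \<omega>))"

text \<open>Independence of the two processes as a whole, i.e. of the random elements of
  \<open>\<real>\<^bsup>[0,\<infinity>)\<^esup>\<close> (with the product sigma-algebra) given by their paths.\<close>

definition indep_processes ::
    "'a measure \<Rightarrow> (real \<Rightarrow> 'a \<Rightarrow> real) \<Rightarrow> (real \<Rightarrow> 'a \<Rightarrow> real) \<Rightarrow> bool" where
  "indep_processes M w1 w2 \<longleftrightarrow>
     prob_space.indep_var M
       (Pi\<^sub>M {0..} (\<lambda>_. borel)) (\<lambda>\<omega>. \<lambda>t\<in>{0..}. w1 t \<omega>)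
       (Pi\<^sub>M {0..} (\<lambda>_. borel)) (\<lambda>\<omega>. \<lambda>t\<in>{0..}. w2 t \<omega>)"

definition Psi :: "real \<times> real \<Rightarrow> real \<times> real \<Rightarrow> real \<times> real" where
  "Psi X v = (fst X + fst v, snd X + fst X * snd v + 1/2 * fst v * snd v)"

context
  fixes w1 w2 :: "real \<Rightarrow> 'a \<Rightarrow> real" and dt :: real
begin

definition incr :: "real \<Rightarrow> real \<Rightarrow> 'a \<Rightarrow> real \<times> real" where
  "incr s t \<omega> = (w1 t \<omega> - w1 s \<omega>, w2 t \<omega> - w2 s \<omega>)"

definition coarse_incr :: "nat \<Rightarrow> 'a \<Rightarrow> real \<times> real" where
  "coarse_incr n = incr (real n * dt) ((real n + 1) * dt)"

definition first_half_incr :: "nat \<Rightarrow> 'a \<Rightarrow> real \<times> real" where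
  "first_half_incr n = incr (real n * dt) ((real n + 1/2) * dt)"

definition second_half_incr :: "nat \<Rightarrow> 'a \<Rightarrow> real \<times> real" where
  "second_half_incr n = incr ((real n + 1/2) * dt) ((real n + 1) * dt)"

primrec coarse_path :: "nat \<Rightarrow> 'a \<Rightarrow> real \<times> real" where
  "coarse_path 0 \<omega> = (0, 0)"
| "coarse_path (Suc n) \<omega> = Psi (coarse_path n \<omega>) (coarse_incr n \<omega>)"

text \<open>In the next two definitions the inner application of \<^const>\<open>Psi\<close> is the value of the path at the
  midpoint \<open>(n + 1/2) * dt\<close>.\<close>

primrec fine_path :: "nat \<Rightarrow> 'a \<Rightarrow> real \<times> real" where
  "fine_path 0 \<omega> = (0, 0)"
| "fine_path (Suc n) \<omega> =
     Psi (Psi (fine_path n \<omega>) (first_half_incr n \<omega>)) (second_half_incr n \<omega>)"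

primrec antithetic_path :: "nat \<Rightarrow> 'a \<Rightarrow> real \<times> real" where
  "antithetic_path 0 \<omega> = (0, 0)"
| "antithetic_path (Suc n) \<omega> =
     Psi (Psi (antithetic_path n \<omega>) (second_half_incr n \<omega>)) (first_half_incr n \<omega>)"

end

end

theory Submission
  imports Defs
begin

text \<open>
  Exchanging the two halves of a time step changes the second component by
  \<open>\<delta>w\<^sub>1 \<delta>w\<^sub>2' - \<delta>w\<^sub>1' \<delta>w\<^sub>2\<close>, where the prime marks the second half. Hence
  \<open>X\<^sup>f\<^sub>2\<^sub>,\<^sub>N - X\<^sup>a\<^sub>2\<^sub>,\<^sub>N\<close> is a signed sum of \<open>2N\<close> products of a half-step increment of \<open>w\<^sub>1\<close> and one of
  \<open>w\<^sub>2\<close>. Every increment occurs in exactly one product, so the products are independent, with mean \<open>0\<close>,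
  second moment \<open>h\<^sup>2\<close> and fourth moment \<open>9h\<^sup>4\<close> for \<open>h = \<Delta>t/2\<close>. For such sums
  the fourth moment is \<open>2N \<cdot> 9h\<^sup>4 + 3 \<cdot> 2N(2N - 1) \<cdot> h\<^sup>4 = 12N(N + 1)h\<^sup>4\<close>.
\<close>

section \<open>Independence of two families taken together\<close>

text \<open>A finite intersection of events about \<open>X\<close> and \<open>Y\<close> splits into
  an \<open>X\<close>-cylinder and a \<open>Y\<close>-cylinder. The hypothesis \<open>XY\<close>
  factors these two apart, then independence within each family factors each of them.\<close>

lemma (in prob_space) indep_vars_Plus:
  assumes X: "indep_vars M1 X I" and Y: "indep_vars M2 Y J"
    and XY: "indep_var (Pi\<^sub>M I M1) (\<lambda>\<omega>. \<lambda>i\<in>I. X i \<omega>) (Pi\<^sub>M J M2) (\<lambda>\<omega>. \<lambda>j\<in>J. Y j \<omega>)"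
  shows "indep_vars (case_sum M1 M2) (case_sum X Y) (I <+> J)"
  unfolding indep_vars_def2
proof (intro conjI ballI indep_setsI)
  show rv: "random_variable (case_sum M1 M2 k) (case_sum X Y k)" if "k \<in> I <+> J" for k
    using X Y that by (auto simp: indep_vars_def)
  show "{case_sum X Y k -` A \<inter> space M |A. A \<in> sets (case_sum M1 M2 k)} \<subseteq> events" if "k \<in> I <+> J" for k
    using rv[OF that] by auto
  fix A K
  assume K: "K \<noteq> {}" "K \<subseteq> I <+> J" "finite K"
    and "\<forall>k\<in>K. A k \<in> {case_sum X Y k -` A \<inter> space M |A. A \<in> sets (case_sum M1 M2 k)}"
  then obtain B where A: "\<And>k. k \<in> K \<Longrightarrow> A k = case_sum X Y k -` B k \<inter> space M"
    and B: "\<And>k. k \<in> K \<Longrightarrow> B k \<in> sets (case_sum M1 M2 k)"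
    by simp metis
  define P where "P = Inl -` K"
  define Q where "Q = Inr -` K"
  have PQ: "finite P" "finite Q" "P \<subseteq> I" "Q \<subseteq> J" "K = P <+> Q"
    using K(2) finite_vimageI[OF K(3), of Inl] finite_vimageI[OF K(3), of Inr]
    by (auto simp: P_def Q_def Plus_def elim!: PlusE)
  \<comment> \<open>Cylinders in the full product spaces: only the finitely many coordinates in
    \<open>P\<close> and \<open>Q\<close> are constrained, so they are measurable even for infinite
    \<open>I\<close> and \<open>J\<close>.\<close>
  define EP where "EP = {f \<in> space (Pi\<^sub>M I M1). \<forall>i\<in>P. f i \<in> B (Inl i)}"
  define EQ where "EQ = {f \<in> space (Pi\<^sub>M J M2). \<forall>j\<in>Q. f j \<in> B (Inr j)}"
  have BP: "B (Inl i) \<in> sets (M1 i)" if "i \<in> P" for i using B[of "Inl i"] that PQ by auto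
  have BQ: "B (Inr j) \<in> sets (M2 j)" if "j \<in> Q" for j using B[of "Inr j"] that PQ by auto
  have AP: "A (Inl i) = X i -` B (Inl i) \<inter> space M" if "i \<in> P" for i
    using A[of "Inl i"] that by (simp add: P_def)
  have AQ: "A (Inr j) = Y j -` B (Inr j) \<inter> space M" if "j \<in> Q" for j
    using A[of "Inr j"] that by (simp add: Q_def)
  have EP: "EP \<in> sets (Pi\<^sub>M I M1)" and EQ: "EQ \<in> sets (Pi\<^sub>M J M2)"
    unfolding EP_def EQ_def using PQ BP BQ
    by (auto intro!: sets.sets_Collect_finite_All' sets_Collect_single' simp: subset_iff)
  have spP: "(\<lambda>i\<in>I. X i \<omega>) \<in> space (Pi\<^sub>M I M1)" if "\<omega> \<in> space M" for \<omega>
    using measurable_space[OF indep_var_rv1[OF XY] that] .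
  have spQ: "(\<lambda>j\<in>J. Y j \<omega>) \<in> space (Pi\<^sub>M J M2)" if "\<omega> \<in> space M" for \<omega>
    using measurable_space[OF indep_var_rv2[OF XY] that] .
  have probP: "prob ((\<lambda>\<omega>. \<lambda>i\<in>I. X i \<omega>) -` EP \<inter> space M) = (\<Prod>i\<in>P. prob (A (Inl i)))"
  \<comment> \<open>\<open>K\<close> is nonempty but may lie in a single summand, while
    \<open>indep_varsD\<close> needs a nonempty index set. For empty \<open>P\<close> the cylinder
    is the whole space and the empty product is 1.\<close>
  proof (cases "P = {}")
    case True
    have "(\<lambda>\<omega>. \<lambda>i\<in>I. X i \<omega>) -` EP \<inter> space M = space M" using spP True by (auto simp: EP_def)
    then show ?thesis using True by (simp add: prob_space)
  next
    case False
    have "(\<lambda>\<omega>. \<lambda>i\<in>I. X i \<omega>) -` EP \<inter> space M = (\<Inter>i\<in>P. X i -` B (Inl i) \<inter> space M)"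
      using spP False PQ by (auto simp: EP_def subset_iff)
    then show ?thesis
      using indep_varsD[OF X False PQ(1,3), of "\<lambda>i. B (Inl i)"] BP by (simp add: AP cong: prod.cong)
  qed
  have probQ: "prob ((\<lambda>\<omega>. \<lambda>j\<in>J. Y j \<omega>) -` EQ \<inter> space M) = (\<Prod>j\<in>Q. prob (A (Inr j)))"
  proof (cases "Q = {}")
    case True
    have "(\<lambda>\<omega>. \<lambda>j\<in>J. Y j \<omega>) -` EQ \<inter> space M = space M" using spQ True by (auto simp: EQ_def)
    then show ?thesis using True by (simp add: prob_space)
  next
    case False
    have "(\<lambda>\<omega>. \<lambda>j\<in>J. Y j \<omega>) -` EQ \<inter> space M = (\<Inter>j\<in>Q. Y j -` B (Inr j) \<inter> space M)"
      using spQ False PQ by (auto simp: EQ_def subset_iff)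
    then show ?thesis
      using indep_varsD[OF Y False PQ(2,4), of "\<lambda>j. B (Inr j)"] BQ by (simp add: AQ cong: prod.cong)
  qed
  have sub: "A k \<subseteq> space M" if "k \<in> K" for k using A[OF that] by auto
  \<comment> \<open>As the preimage of a rectangle, the event has the form to which
    \<open>indep_varD\<close> applies.\<close>
  have "(\<Inter>k\<in>K. A k) = (\<lambda>\<omega>. (\<lambda>i\<in>I. X i \<omega>, \<lambda>j\<in>J. Y j \<omega>)) -` (EP \<times> EQ) \<inter> space M" (is "?L = ?R")
  proof (intro set_eqI)
    fix \<omega>
    have "\<omega> \<in> ?L \<longleftrightarrow> \<omega> \<in> space M \<and> (\<forall>k\<in>K. \<omega> \<in> A k)"
      using K(1) sub by auto
    also have "\<dots> \<longleftrightarrow> \<omega> \<in> space M \<and> (\<forall>k\<in>K. case_sum X Y k \<omega> \<in> B k)"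
      using A by auto
    also have "\<dots> \<longleftrightarrow> \<omega> \<in> ?R"
      using spP spQ PQ(3,4) unfolding PQ(5) EP_def EQ_def by (auto simp: subset_iff Plus_def ball_Un)
    finally show "\<omega> \<in> ?L \<longleftrightarrow> \<omega> \<in> ?R" .
  qed
  then have "prob (\<Inter>k\<in>K. A k) = (\<Prod>i\<in>P. prob (A (Inl i))) * (\<Prod>j\<in>Q. prob (A (Inr j)))"
    using indep_varD[OF XY EP EQ] by (simp only: probP probQ)
  also have "\<dots> = (\<Prod>k\<in>K. prob (A k))"
    unfolding PQ(5) using PQ(1,2) by (simp add: prod.Plus)
  finally show "prob (\<Inter>k\<in>K. A k) = (\<Prod>k\<in>K. prob (A k))" .
qed

section \<open>Gaussian moments and fourth moments of independent sums\<close>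

lemma (in prob_space) normal_moments:
  assumes D: "distributed M lborel X (normal_density 0 \<sigma>)" and \<sigma>: "0 < \<sigma>"
  shows "integrable M (\<lambda>\<omega>. X \<omega> ^ k)" "expectation X = 0"
    "expectation (\<lambda>\<omega>. X \<omega> ^ 2) = \<sigma>\<^sup>2" "expectation (\<lambda>\<omega>. X \<omega> ^ 4) = 3 * \<sigma> ^ 4"
proof -
  have E: "expectation (\<lambda>\<omega>. X \<omega> ^ k) = (\<integral>x. normal_density 0 \<sigma> x * x ^ k \<partial>lborel)" for k
    by (rule distributed_integral[OF D, symmetric]) auto
  show "integrable M (\<lambda>\<omega>. X \<omega> ^ k)"
    using distributed_integrable[OF D, of "\<lambda>x. x ^ k"] integrable_normal_moment[OF \<sigma>, of 0 k] by simp
  show "expectation X = 0"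
    using E[of 1] integral_normal_moment_odd[OF \<sigma>, of 0 0] by simp
  show "expectation (\<lambda>\<omega>. X \<omega> ^ 2) = \<sigma>\<^sup>2"
    using E[of 2] integral_normal_moment_even[OF \<sigma>, of 0 1] \<sigma> by (simp add: fact_numeral)
  \<comment> \<open>The factor 3 is 4!/(2^2 * 2!).\<close>
  show "expectation (\<lambda>\<omega>. X \<omega> ^ 4) = 3 * \<sigma> ^ 4"
    using E[of 4] integral_normal_moment_even[OF \<sigma>, of 0 2] \<sigma>
    by (simp add: fact_numeral power_divide field_simps flip: power_mult)
qed

lemma (in prob_space) indep_var_power:
  fixes X Y :: "'a \<Rightarrow> real"
  assumes "indep_var borel X borel Y"
    and "integrable M (\<lambda>\<omega>. X \<omega> ^ j)" "integrable M (\<lambda>\<omega>. Y \<omega> ^ k)"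
  shows "integrable M (\<lambda>\<omega>. X \<omega> ^ j * Y \<omega> ^ k)"
    and "expectation (\<lambda>\<omega>. X \<omega> ^ j * Y \<omega> ^ k) = expectation (\<lambda>\<omega>. X \<omega> ^ j) * expectation (\<lambda>\<omega>. Y \<omega> ^ k)"
proof -
  have "indep_var borel (\<lambda>\<omega>. X \<omega> ^ j) borel (\<lambda>\<omega>. Y \<omega> ^ k)"
    using indep_var_compose[OF assms(1), of "\<lambda>x. x ^ j" borel "\<lambda>x. x ^ k" borel] by (simp add: comp_def)
  then show "integrable M (\<lambda>\<omega>. X \<omega> ^ j * Y \<omega> ^ k)"
    and "expectation (\<lambda>\<omega>. X \<omega> ^ j * Y \<omega> ^ k) = expectation (\<lambda>\<omega>. X \<omega> ^ j) * expectation (\<lambda>\<omega>. Y \<omega> ^ k)"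
    using assms(2,3) by (auto intro: indep_var_integrable indep_var_lebesgue_integral)
qed

text \<open>Induction on \<open>I\<close>: a new summand is independent of the sum of the others, so
  the binomial expansion of a power becomes a sum of products of moments. The fourth moment draws on
  the mean, the second moment and integrability of the shorter sum, hence the joint
  statement.\<close>

lemma (in prob_space) indep_sum_moments:
  fixes Z :: "'i \<Rightarrow> 'a \<Rightarrow> real" and v q :: real
  assumes "finite I" "indep_vars (\<lambda>_. borel) Z I"
    and "\<And>i k. i \<in> I \<Longrightarrow> k \<le> 4 \<Longrightarrow> integrable M (\<lambda>\<omega>. Z i \<omega> ^ k)"
    and "\<And>i. i \<in> I \<Longrightarrow> expectation (Z i) = 0"
    and "\<And>i. i \<in> I \<Longrightarrow> expectation (\<lambda>\<omega>. Z i \<omega> ^ 2) = v"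
    and "\<And>i. i \<in> I \<Longrightarrow> expectation (\<lambda>\<omega>. Z i \<omega> ^ 4) = q"
  shows "(\<forall>k\<le>4. integrable M (\<lambda>\<omega>. (\<Sum>i\<in>I. Z i \<omega>) ^ k)) \<and>
    expectation (\<lambda>\<omega>. \<Sum>i\<in>I. Z i \<omega>) = 0 \<and>
    expectation (\<lambda>\<omega>. (\<Sum>i\<in>I. Z i \<omega>) ^ 2) = card I * v \<and>
    expectation (\<lambda>\<omega>. (\<Sum>i\<in>I. Z i \<omega>) ^ 4) = card I * q + 3 * card I * (real (card I) - 1) * v\<^sup>2"
  using assms
proof (induction I)
  case empty
  then show ?case by simp
next
  case (insert i I)
  let ?S = "\<lambda>\<omega>. \<Sum>i\<in>I. Z i \<omega>"
  have IH: "\<And>k. k \<le> 4 \<Longrightarrow> integrable M (\<lambda>\<omega>. ?S \<omega> ^ k)" "expectation ?S = 0"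
    "expectation (\<lambda>\<omega>. ?S \<omega> ^ 2) = card I * v"
    "expectation (\<lambda>\<omega>. ?S \<omega> ^ 4) = card I * q + 3 * card I * (real (card I) - 1) * v\<^sup>2"
    using insert.IH insert.prems by (auto intro: indep_vars_subset)
  have ind: "indep_var borel (Z i) borel ?S"
    by (rule indep_vars_sum) (use insert in auto)
  have Zi: "\<And>k. k \<le> 4 \<Longrightarrow> integrable M (\<lambda>\<omega>. Z i \<omega> ^ k)" "expectation (Z i) = 0"
    "expectation (\<lambda>\<omega>. Z i \<omega> ^ 2) = v" "expectation (\<lambda>\<omega>. Z i \<omega> ^ 4) = q"
    using insert.prems by auto
  have sum_eq: "(\<Sum>j\<in>insert i I. Z j \<omega>) ^ k =
      (\<Sum>j\<le>k. real (k choose j) * (Z i \<omega> ^ j * ?S \<omega> ^ (k - j)))" for k \<omega>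
    using insert.hyps by (simp add: binomial_ring mult.assoc)
  have int: "integrable M (\<lambda>\<omega>. Z i \<omega> ^ j * ?S \<omega> ^ (k - j))" if "k \<le> 4" "j \<le> k" for j k
    using that by (intro indep_var_power[OF ind] Zi IH) auto
  have expand: "expectation (\<lambda>\<omega>. (\<Sum>j\<in>insert i I. Z j \<omega>) ^ k) =
      (\<Sum>j\<le>k. real (k choose j) * (expectation (\<lambda>\<omega>. Z i \<omega> ^ j) * expectation (\<lambda>\<omega>. ?S \<omega> ^ (k - j))))"
    if "k \<le> 4" for k
    unfolding sum_eq using that
    by (subst Bochner_Integration.integral_sum)
       (auto intro!: sum.cong int indep_var_power[OF ind] Zi IH)
  have "integrable M (\<lambda>\<omega>. (\<Sum>j\<in>insert i I. Z j \<omega>) ^ k)" if "k \<le> 4" for k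
    unfolding sum_eq using that by (auto intro!: int)
  moreover have "expectation (\<lambda>\<omega>. \<Sum>j\<in>insert i I. Z j \<omega>) = 0"
    using expand[of 1] IH Zi by (simp add: prob_space)
  moreover have "expectation (\<lambda>\<omega>. (\<Sum>j\<in>insert i I. Z j \<omega>) ^ 2) = card (insert i I) * v"
    using expand[of 2] IH Zi insert.hyps
    by (simp add: prob_space numeral_2_eq_2 algebra_simps)
  moreover have "expectation (\<lambda>\<omega>. (\<Sum>j\<in>insert i I. Z j \<omega>) ^ 4) =
      card (insert i I) * q + 3 * card (insert i I) * (real (card (insert i I)) - 1) * v\<^sup>2"
  \<comment> \<open>The terms with \<open>j = 1\<close> and \<open>j = 3\<close> contain a zero
    mean, so third moments never have to be known. With m = \<open>card I\<close>, the rest adds q +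
    6 m v^2 to the old value, and 3(m+1)m - 3m(m-1) = 6m.\<close>
  proof -
    have "{..4} = {0, 1, 2, 3, 4::nat}" by auto
    moreover have "(4 choose 2) = (6::nat)" "(4 choose 3) = (4::nat)" by (simp_all add: eval_nat_numeral)
    ultimately show ?thesis
      using expand[of 4] IH Zi insert.hyps
      by (simp add: prob_space power2_eq_square algebra_simps)
  qed
  ultimately show ?case by blast
qed

text \<open>\<open>\<pi>\<close> says which \<open>Y\<close> is multiplied with which
  \<open>X\<close>; injectivity prevents any \<open>Y\<close> from being used twice. Integrability
  is proved along with the value, since the integral of a nonintegrable function is 0 by
  convention.\<close>

lemma (in prob_space) signed_product_sum_moments:
  fixes X Y :: "nat \<Rightarrow> 'a \<Rightarrow> real"
  assumes ind: "indep_vars (\<lambda>_. borel) (case_sum X Y) ({..<n} <+> {..<n})"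
    and \<sigma>: "0 < \<sigma>"
    and X: "\<And>j. j < n \<Longrightarrow> distributed M lborel (X j) (normal_density 0 \<sigma>)"
    and Y: "\<And>j. j < n \<Longrightarrow> distributed M lborel (Y j) (normal_density 0 \<sigma>)"
    and \<pi>: "inj_on \<pi> {..<n}" "\<pi> ` {..<n} \<subseteq> {..<n}"
    and s: "\<And>j. \<bar>s j\<bar> = 1"
  shows "integrable M (\<lambda>\<omega>. (\<Sum>j<n. s j * (X j \<omega> * Y (\<pi> j) \<omega>)) ^ 4)"
    and "expectation (\<lambda>\<omega>. (\<Sum>j<n. s j * (X j \<omega> * Y (\<pi> j) \<omega>)) ^ 4) = 3 * real n * (real n + 2) * \<sigma> ^ 8"
proof -
  define Z where "Z = (\<lambda>j \<omega>. s j * (X j \<omega> * Y (\<pi> j) \<omega>))"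
  \<comment> \<open>The pairs of indices used by different products are disjoint blocks of the joint
    family, so functions of the blocks are independent.\<close>
  let ?K = "\<lambda>j. {Inl j, Inr (\<pi> j)} :: (nat + nat) set"
  have "indep_vars (\<lambda>j. Pi\<^sub>M (?K j) (\<lambda>_. borel)) (\<lambda>j \<omega>. restrict (\<lambda>i. case_sum X Y i \<omega>) (?K j)) {..<n}"
    using \<pi> by (intro indep_vars_restrict[OF ind]) (auto simp: disjoint_family_on_def inj_on_def)
  then have "indep_vars (\<lambda>_. borel)
      (\<lambda>j \<omega>. (\<lambda>f. s j * (f (Inl j) * f (Inr (\<pi> j)))) (restrict (\<lambda>i. case_sum X Y i \<omega>) (?K j))) {..<n}"
    by (rule indep_vars_compose2) measurable
  then have indZ: "indep_vars (\<lambda>_. borel) Z {..<n}"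
    by (simp add: Z_def)
  have pair: "indep_var borel (X j) borel (Y (\<pi> j))" if "j < n" for j
  proof -
    have "indep_var (Pi\<^sub>M {Inl j} (\<lambda>_. borel)) (\<lambda>\<omega>. restrict (\<lambda>i. case_sum X Y i \<omega>) {Inl j})
        (Pi\<^sub>M {Inr (\<pi> j)} (\<lambda>_. borel)) (\<lambda>\<omega>. restrict (\<lambda>i. case_sum X Y i \<omega>) {Inr (\<pi> j)})"
      using \<pi> that by (intro indep_var_restrict[OF ind]) auto
    from indep_var_compose[OF this, of "\<lambda>f. f (Inl j)" borel "\<lambda>f. f (Inr (\<pi> j))" borel]
    show ?thesis by (simp add: comp_def)
  qed
  \<comment> \<open>The signs enter the second and fourth moments only through even powers; the mean
    is 0 for either sign.\<close>
  have s_even: "s j ^ 2 = 1" "s j ^ 4 = 1" for j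
    using s[of j] by (auto simp: abs_if split: if_splits)
  have Xm: "integrable M (\<lambda>\<omega>. X j \<omega> ^ k)" "expectation (X j) = 0"
      "expectation (\<lambda>\<omega>. X j \<omega> ^ 2) = \<sigma>\<^sup>2" "expectation (\<lambda>\<omega>. X j \<omega> ^ 4) = 3 * \<sigma> ^ 4" if "j < n" for j k
    using normal_moments[OF X[OF that] \<sigma>] by auto
  have Ym: "integrable M (\<lambda>\<omega>. Y (\<pi> j) \<omega> ^ k)"
      "expectation (\<lambda>\<omega>. Y (\<pi> j) \<omega> ^ 2) = \<sigma>\<^sup>2" "expectation (\<lambda>\<omega>. Y (\<pi> j) \<omega> ^ 4) = 3 * \<sigma> ^ 4" if "j < n" for j k
    using normal_moments[OF Y \<sigma>] that \<pi>(2) by auto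
  have Zpow: "Z j \<omega> ^ k = s j ^ k * (X j \<omega> ^ k * Y (\<pi> j) \<omega> ^ k)" for j k \<omega>
    by (simp add: Z_def power_mult_distrib)
  have Zint: "integrable M (\<lambda>\<omega>. Z j \<omega> ^ k)"
    and Zexp: "expectation (\<lambda>\<omega>. Z j \<omega> ^ k) = s j ^ k * (expectation (\<lambda>\<omega>. X j \<omega> ^ k) * expectation (\<lambda>\<omega>. Y (\<pi> j) \<omega> ^ k))"
    if "j < n" for j k
    unfolding Zpow using indep_var_power[OF pair Xm(1) Ym(1)] that by auto
  \<comment> \<open>Each product has second moment \<sigma>^4 and fourth moment (3\<sigma>^4)^2 =
    9\<sigma>^8. The final form is 9n + 3n(n-1) = 3n(n+2).\<close>
  have "(\<forall>k\<le>4. integrable M (\<lambda>\<omega>. (\<Sum>j<n. Z j \<omega>) ^ k)) \<and>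
    expectation (\<lambda>\<omega>. \<Sum>j<n. Z j \<omega>) = 0 \<and>
    expectation (\<lambda>\<omega>. (\<Sum>j<n. Z j \<omega>) ^ 2) = card {..<n} * \<sigma> ^ 4 \<and>
    expectation (\<lambda>\<omega>. (\<Sum>j<n. Z j \<omega>) ^ 4) =
      card {..<n} * (9 * \<sigma> ^ 8) + 3 * card {..<n} * (real (card {..<n}) - 1) * (\<sigma> ^ 4)\<^sup>2"
  proof (rule indep_sum_moments[OF _ indZ])
    show "expectation (Z j) = 0" if "j \<in> {..<n}" for j
      using Zexp[of j 1] Xm(2) that by simp
    show "expectation (\<lambda>\<omega>. Z j \<omega> ^ 2) = \<sigma> ^ 4" if "j \<in> {..<n}" for j
      using Zexp[of j 2] Xm(3) Ym(2) that by (simp add: s_even flip: power_add)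
    show "expectation (\<lambda>\<omega>. Z j \<omega> ^ 4) = 9 * \<sigma> ^ 8" if "j \<in> {..<n}" for j
      using Zexp[of j 4] Xm(4) Ym(3) that by (simp add: s_even flip: power_add)
  qed (use Zint in auto)
  then show "integrable M (\<lambda>\<omega>. (\<Sum>j<n. s j * (X j \<omega> * Y (\<pi> j) \<omega>)) ^ 4)"
    and "expectation (\<lambda>\<omega>. (\<Sum>j<n. s j * (X j \<omega> * Y (\<pi> j) \<omega>)) ^ 4) = 3 * real n * (real n + 2) * \<sigma> ^ 8"
    by (simp_all add: Z_def algebra_simps flip: power_mult)
qed

section \<open>Brownian increments on an equidistant grid\<close>

lemma std_brownian_motion_increments:
  fixes h :: real
  assumes w: "std_brownian_motion M w" and h: "0 < h"
  shows "prob_space.indep_vars M (\<lambda>_. borel) (\<lambda>j \<omega>. w (real (Suc j) * h) \<omega> - w (real j * h) \<omega>) {..<n}"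
    and "distributed M lborel (\<lambda>\<omega>. w (real (Suc j) * h) \<omega> - w (real j * h) \<omega>) (normal_density 0 (sqrt h))"
proof -
  show "prob_space.indep_vars M (\<lambda>_. borel) (\<lambda>j \<omega>. w (real (Suc j) * h) \<omega> - w (real j * h) \<omega>) {..<n}"
  proof -
    have "0 \<le> t 0 \<and> (\<forall>i<n. t i < t (Suc i)) \<Longrightarrow>
        prob_space.indep_vars M (\<lambda>_. borel) (\<lambda>i \<omega>. w (t (Suc i)) \<omega> - w (t i) \<omega>) {..<n}" for t :: "nat \<Rightarrow> real"
      using w unfolding std_brownian_motion_def by blast
    from this[of "\<lambda>j. real j * h"] show ?thesis using h by simp
  qed
  have "0 \<le> real j * h \<and> real j * h < real (Suc j) * h" using h by simp
  then have "distributed M lborel (\<lambda>\<omega>. w (real (Suc j) * h) \<omega> - w (real j * h) \<omega>)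
      (normal_density 0 (sqrt (real (Suc j) * h - real j * h)))"
    using w unfolding std_brownian_motion_def by blast
  then show "distributed M lborel (\<lambda>\<omega>. w (real (Suc j) * h) \<omega> - w (real j * h) \<omega>) (normal_density 0 (sqrt h))"
    by (simp add: algebra_simps)
qed

text \<open>The vector of grid increments is a measurable function of the path in the product
  sigma-algebra, so independence of the processes passes to the two vectors;
  \<open>indep_vars_Plus\<close> then joins the families.\<close>

lemma indep_processes_increments:
  fixes h :: real
  assumes w1: "std_brownian_motion M w1" and w2: "std_brownian_motion M w2"
    and indep: "indep_processes M w1 w2" and h: "0 < h"
  shows "prob_space.indep_vars M (\<lambda>_. borel)
    (case_sum (\<lambda>j \<omega>. w1 (real (Suc j) * h) \<omega> - w1 (real j * h) \<omega>)
      (\<lambda>j \<omega>. w2 (real (Suc j) * h) \<omega> - w2 (real j * h) \<omega>)) ({..<n} <+> {..<n})"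
proof -
  interpret prob_space M using w1 by (simp add: std_brownian_motion_def)
  have const: "case_sum (\<lambda>_. borel) (\<lambda>_. borel) = (\<lambda>_. borel :: real measure)"
    by (simp add: fun_eq_iff split: sum.split)
  let ?f = "\<lambda>p. \<lambda>j\<in>{..<n}. p (real (Suc j) * h) - p (real j * h) :: real"
  \<comment> \<open>Positivity of \<open>h\<close> places all grid times in \<open>{0..}\<close>,
    where the coordinate maps are measurable.\<close>
  have "?f \<in> Pi\<^sub>M {0..} (\<lambda>_. borel) \<rightarrow>\<^sub>M Pi\<^sub>M {..<n} (\<lambda>_. borel)"
    using h by (intro measurable_restrict borel_measurable_diff measurable_component_singleton) auto
  from indep_var_compose[OF indep[unfolded indep_processes_def] this this]
  have "indep_var (Pi\<^sub>M {..<n} (\<lambda>_. borel)) (\<lambda>\<omega>. \<lambda>j\<in>{..<n}. w1 (real (Suc j) * h) \<omega> - w1 (real j * h) \<omega>)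
      (Pi\<^sub>M {..<n} (\<lambda>_. borel)) (\<lambda>\<omega>. \<lambda>j\<in>{..<n}. w2 (real (Suc j) * h) \<omega> - w2 (real j * h) \<omega>)"
    using h by (simp add: comp_def cong: restrict_cong)
  from indep_vars_Plus[OF std_brownian_motion_increments(1)[OF w1 h]
      std_brownian_motion_increments(1)[OF w2 h] this]
  show ?thesis 
    by (simp add: const)
qed

section \<open>Pathwise identities for the three schemes\<close>

text \<open>Let a and b be the two half increments of a step. Adding both orders, the mixed terms a1
  b2 and b1 a2 occur once each and complete a1 a2 + b1 b2 to (a1 + b1)(a2 + b2), twice the coarse
  correction. The induction for the second components needs equality of the first ones.\<close>

lemma paths_agree:
  "fst (fine_path w1 w2 dt n \<omega>) = fst (coarse_path w1 w2 dt n \<omega>) \<and>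
   fst (antithetic_path w1 w2 dt n \<omega>) = fst (coarse_path w1 w2 dt n \<omega>) \<and>
   snd (fine_path w1 w2 dt n \<omega>) + snd (antithetic_path w1 w2 dt n \<omega>) = 2 * snd (coarse_path w1 w2 dt n \<omega>)"
  by (induction n)
     (auto simp: Psi_def incr_def coarse_incr_def first_half_incr_def second_half_incr_def algebra_simps)

text \<open>Half steps are numbered consecutively: \<open>2 * n\<close> and \<open>2 * n + 1\<close>
  are the halves of step \<open>n\<close>. Each is sent to its partner in the same step.\<close>

definition swap_halves :: "nat \<Rightarrow> nat" where
  "swap_halves j = (if even j then Suc j else j - 1)"

lemma inj_swap_halves: "inj_on swap_halves A"
  \<comment> \<open>The map is an involution, hence its own inverse.\<close>
  by (rule inj_on_inverseI[where g=swap_halves]) (auto simp: swap_halves_def elim: oddE)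

lemma swap_halves_image_subset: "swap_halves ` {..<2 * n} \<subseteq> {..<2 * n}"
  \<comment> \<open>The bound is even, so no pair is cut: an even \<open>j < 2 * n\<close> has
    \<open>Suc j < 2 * n\<close>.\<close>
  by (auto simp: swap_halves_def elim!: evenE)

lemma path_difference:
  fixes dt :: real
  defines "h \<equiv> dt / 2"
  shows "snd (fine_path w1 w2 dt n \<omega>) - snd (antithetic_path w1 w2 dt n \<omega>) =
    (\<Sum>j<2 * n. (- 1) ^ j * ((w1 (real (Suc j) * h) \<omega> - w1 (real j * h) \<omega>) *
       (w2 (real (Suc (swap_halves j)) * h) \<omega> - w2 (real (swap_halves j) * h) \<omega>)))"
proof (induction n)
  case (Suc n)
  \<comment> \<open>The start, midpoint and end of step \<open>n\<close> as points of the half-step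
    grid, used right to left below.\<close>
  have t: "real (2 * n) * h = real n * dt" "real (Suc (2 * n)) * h = (real n + 1/2) * dt"
    "real (Suc (Suc (2 * n))) * h = (real n + 1) * dt"
    by (simp_all add: h_def field_simps)
  \<comment> \<open>Both paths have the same first component, so all terms containing it cancel.
    What remains is the summand for \<open>j = 2 * n\<close>, with sign +, and the one for
    \<open>j = 2 * n + 1\<close>, with sign -.\<close>
  have "snd (fine_path w1 w2 dt (Suc n) \<omega>) - snd (antithetic_path w1 w2 dt (Suc n) \<omega>) =
    snd (fine_path w1 w2 dt n \<omega>) - snd (antithetic_path w1 w2 dt n \<omega>) +
    (fst (first_half_incr w1 w2 dt n \<omega>) * snd (second_half_incr w1 w2 dt n \<omega>) -
     fst (second_half_incr w1 w2 dt n \<omega>) * snd (first_half_incr w1 w2 dt n \<omega>))"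
    using paths_agree[of w1 w2 dt n \<omega>] by (simp add: Psi_def algebra_simps)
  then show ?case
    unfolding Suc.IH first_half_incr_def second_half_incr_def incr_def t[symmetric]
    by (simp add: swap_halves_def del: of_nat_Suc of_nat_mult)
qed simp

section \<open>Fourth moment at the final time\<close>

theorem lemma3p1:
  fixes M :: "'a measure" and w1 w2 :: "real \<Rightarrow> 'a \<Rightarrow> real"
    and T dt :: real and N :: nat
    and Xf Xa Xc :: "nat \<Rightarrow> 'a \<Rightarrow> real \<times> real"
  assumes bm1: "std_brownian_motion M w1"
    and bm2: "std_brownian_motion M w2"
    and indep: "indep_processes M w1 w2"
    and T: "T > 0"
    and N: "N \<ge> 1"
    and dt: "dt = T / real N"
    and Xf: "Xf = fine_path w1 w2 dt"
    and Xa: "Xa = antithetic_path w1 w2 dt"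
    and Xc: "Xc = coarse_path w1 w2 dt"
  shows "(\<forall>\<omega>\<in>space M. \<forall>n\<le>N.
            fst (Xf n \<omega>) = fst (Xa n \<omega>) \<and> fst (Xa n \<omega>) = fst (Xc n \<omega>) \<and>
            1/2 * (snd (Xf n \<omega>) + snd (Xa n \<omega>)) = snd (Xc n \<omega>))
       \<and> integrable M (\<lambda>\<omega>. (snd (Xf N \<omega>) - snd (Xa N \<omega>)) ^ 4)
       \<and> prob_space.expectation M (\<lambda>\<omega>. (snd (Xf N \<omega>) - snd (Xa N \<omega>)) ^ 4)
           = 3/4 * T * (T + dt) * dt\<^sup>2"
proof -
  interpret prob_space M using bm1 by (simp add: std_brownian_motion_def)
  have pos: "0 < dt / 2" using T N dt by simp
  have dtN: "dt * real N = T" using N dt by simp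
  \<comment> \<open>There are \<open>2 * N\<close> half steps, and each increment has standard
    deviation \<open>sqrt (dt / 2)\<close>.\<close>
  note moments = signed_product_sum_moments[where n="2 * N" and s="\<lambda>j. (- 1) ^ j",
      OF indep_processes_increments[OF bm1 bm2 indep pos] _
      std_brownian_motion_increments(2)[OF bm1 pos] std_brownian_motion_increments(2)[OF bm2 pos]
      inj_swap_halves swap_halves_image_subset]
  have "sqrt (dt / 2) ^ 8 = ((sqrt (dt / 2))\<^sup>2) ^ 4" by (simp flip: power_mult)
  also have "\<dots> = dt ^ 4 / 16" using pos by (simp add: power_divide)
  finally have sqrt8: "sqrt (dt / 2) ^ 8 = dt ^ 4 / 16" .
  have "3/4 * T * (T + dt) * dt\<^sup>2 = 3/4 * real N * (real N + 1) * dt ^ 4"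
    unfolding dtN[symmetric] by (simp add: power2_eq_square power4_eq_xxxx algebra_simps)
  \<comment> \<open>3 * 2N * (2N + 2) = 12 N (N + 1), and 12/16 = 3/4; two of the four factors
    \<open>dt\<close> combine with N and N + 1 into \<open>T\<close> and
    \<open>T + dt\<close>.\<close>
  then have scaling: "3 * real (2 * N) * (real (2 * N) + 2) * sqrt (dt / 2) ^ 8 = 3/4 * T * (T + dt) * dt\<^sup>2"
    by (simp add: sqrt8 algebra_simps)
  \<comment> \<open>\<open>power_abs\<close> settles the remaining condition that the signs
    \<open>(- 1) ^ j\<close> have absolute value 1.\<close>
  show ?thesis
    unfolding Xf Xa Xc path_difference scaling[symmetric]
    using moments pos paths_agree[of w1 w2 dt] by (simp add: power_abs)
qed

end
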